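(* Let $X$ be a real Hilbert space, $\mathcal P:X\to X$ a bounded linear projection with range $V$ and kernel $W$, $q:X\to\mathbb R$ a continuous quadratic function whose second derivative $b=q''$ is positive definite on $V$, $\tilde V\subset X$ a closed linear subspace, and $\tilde b$ a bounded symmetric bilinear form that is elliptic on $\tilde V$. Suppose $V\subset W+\tilde V$. Let $x_0\in V$ and $[\xi_0]\in X/W$ be initial values with $x_0\in[\xi_0]$. Then the sequences of iterates $x_k$ and $[\xi_k]$ generated by the PDP algorithm (from $x_0$) and by the steepest descent algorithm in $X/W$ (from $[\xi_0]$), respectively, coincide, i.e. $x_k\in[\xi_k]$ for all $k$.
   Context: Setting: $X$ is a real Hilbert space with dual $X^*$; $q:X\to\mathbb R$ is continuous and quadratic, so $b:=q''(x)$ is a bounded symmetric bilinear form independent of $x$ and $q(x+\delta x)=q(x)+q'(x)\delta x+\tfrac12 b(\delta x,\delta x)$. $\mathcal P:X\to X$ is a bounded linear (not necessarily orthogonal) projection, $V=\operatorname{ran}\mathcal P$, $W=\ker\mathcal P$, and $\mathcal P^*:X^*\to X^*$ is its adjoint. The problem is $\min_{x\in V}q(x)$. $\tilde V\subset X$ is a closed linear subspace and $\tilde b$ is a bounded symmetric bilinear form, elliptic on $\tilde V$ (there is $\alpha>0$ with $\tilde b(v,v)\ge\alpha\|v\|^2$ for all $v\in\tilde V$). PDP (primal dual projection) algorithm, initial iterate $x_0\in V$; for $k=0,1,2,\dots$: 1. $\lambda_k=\mathcal P^*q'(x_k)-q'(x_k)\in X^*$; 2. $\delta y_k=\operatorname{arg\,min}_{v\in\tilde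 V}\; q'(x_k)v+\tfrac12\tilde b(v,v)+\lambda_k v$; 3. $\delta x_k=\mathcal P\,\delta y_k$; 4. $x_{k+1}=x_k+\omega_k\delta x_k$ with $\omega_k=-\dfrac{q'(x_k)\delta x_k}{b(\delta x_k,\delta x_k)}$ (if $\delta x_k=0$, set $x_{k+1}=x_k$). Steepest descent algorithm in $X/W$: elements of the quotient space $X/W$ are classes $[\xi]=\xi+W$. Define $f:X/W\to\mathbb R$ by $f([\xi])=q(\mathcal P\xi)$, so $f'([\xi])[v]=q'(\mathcal P\xi)\mathcal Pv$ and $f''([\xi])([v],[v])=b(\mathcal Pv,\mathcal Pv)$, and $\langle[v],[v]\rangle:=\inf_{\nu\in[v]\cap\tilde V}\tilde b(\nu,\nu)$. Given $[\xi_0]\in X/W$, for $k=0,1,2,\dots$: 1. $[\delta\xi_k]=\operatorname{arg\,min}_{[v]\in X/W}\;\tfrac12\langle[v],[v]\rangle+f'([\xi_k])[v]$; 2. $\omega_k=-\dfrac{f'([\xi_k])[\delta\xi_k]}{f''([\xi_k])([\delta\xi_k],[\delta\xi_k])}$; 3. $[\xi_{k+1}]=[\xi_k]+\omega_k[\delta\xi_k]$ (if $[\delta\xi_k]=0$, set $[\xi_{k+1}]=[\xi_k]$). *)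

theory Defs
  imports "HOL-Analysis.Analysis"
begin

section \<open>Continuous quadratic functions and their derivatives\<close>

text \<open>Symmetry of \<open>B\<close> is no restriction: only its symmetric part enters.\<close>

definition quadratic_function :: "('a::real_normed_vector \<Rightarrow> real) \<Rightarrow> bool" where
  "quadratic_function q \<longleftrightarrow>
     (\<exists>c l B. linear l \<and> bilinear B \<and> (\<forall>u v. B u v = B v u) \<and>
        (\<forall>x. q x = c + l x + 1 / 2 * B x x))"

text \<open>The derivative \<open>q'(x)\<close> as an element of the dual space.\<close>

definition first_deriv :: "('a::real_normed_vector \<Rightarrow> real) \<Rightarrow> 'a \<Rightarrow> 'a \<Rightarrow>\<^sub>L real" where
  "first_deriv q x = Blinfun (frechet_derivative q (at x))"

text \<open>The bilinear form \<open>(u, v) \<mapsto> q''(x)(u, v)\<close>.\<close>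

definition second_deriv :: "('a::real_normed_vector \<Rightarrow> real) \<Rightarrow> 'a \<Rightarrow> 'a \<Rightarrow> 'a \<Rightarrow> real" where
  "second_deriv q x u v = blinfun_apply (frechet_derivative (first_deriv q) (at x) u) v"

text \<open>The form \<open>b\<close>. The base point \<open>0\<close> is immaterial for continuous quadratic \<open>q\<close>;
  see \<open>second_deriv_const\<close> below.\<close>

definition hess :: "('a::real_normed_vector \<Rightarrow> real) \<Rightarrow> 'a \<Rightarrow> 'a \<Rightarrow> real" where
  "hess q = second_deriv q 0"

section \<open>Projection, adjoint and ellipticity\<close>

definition ker :: "('a::real_normed_vector \<Rightarrow>\<^sub>L 'b::real_normed_vector) \<Rightarrow> 'a set" where
  "ker P = {x. blinfun_apply P x = 0}"

definition dual_adjoint ::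
    "('a::real_normed_vector \<Rightarrow>\<^sub>L 'a) \<Rightarrow> ('a \<Rightarrow>\<^sub>L real) \<Rightarrow> ('a \<Rightarrow>\<^sub>L real)" where
  "dual_adjoint P \<phi> = \<phi> o\<^sub>L P"

definition elliptic_on :: "'a::real_normed_vector set \<Rightarrow> ('a \<Rightarrow> 'a \<Rightarrow> real) \<Rightarrow> bool" where
  "elliptic_on S B \<longleftrightarrow> (\<exists>\<alpha>>0. \<forall>v\<in>S. B v v \<ge> \<alpha> * (norm v)\<^sup>2)"

section \<open>The primal dual projection algorithm\<close>

text \<open>\<open>arg_min\<close> picks some minimizer and is unspecified if there is none. In both algorithms
  existence and uniqueness of the minimizer follow from ellipticity (and, in the quotient
  space, from \<open>range P \<subseteq> ker P + Vt\<close>).\<close>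

definition pdp_lambda ::
    "('a::real_normed_vector \<Rightarrow> real) \<Rightarrow> ('a \<Rightarrow>\<^sub>L 'a) \<Rightarrow> 'a \<Rightarrow> ('a \<Rightarrow>\<^sub>L real)" where
  "pdp_lambda q P x = dual_adjoint P (first_deriv q x) - first_deriv q x"

definition pdp_dy ::
    "('a::real_normed_vector \<Rightarrow> real) \<Rightarrow> ('a \<Rightarrow>\<^sub>L 'a) \<Rightarrow> 'a set \<Rightarrow> ('a \<Rightarrow> 'a \<Rightarrow> real) \<Rightarrow> 'a \<Rightarrow> 'a" where
  "pdp_dy q P Vt bt x =
     arg_min (\<lambda>v. first_deriv q x v + 1 / 2 * bt v v + pdp_lambda q P x v) (\<lambda>v. v \<in> Vt)"

definition pdp_dx ::
    "('a::real_normed_vector \<Rightarrow> real) \<Rightarrow> ('a \<Rightarrow>\<^sub>L 'a) \<Rightarrow> 'a set \<Rightarrow> ('a \<Rightarrow> 'a \<Rightarrow> real) \<Rightarrow> 'a \<Rightarrow> 'a" where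
  "pdp_dx q P Vt bt x = P (pdp_dy q P Vt bt x)"

definition pdp_step ::
    "('a::real_normed_vector \<Rightarrow> real) \<Rightarrow> ('a \<Rightarrow>\<^sub>L 'a) \<Rightarrow> 'a set \<Rightarrow> ('a \<Rightarrow> 'a \<Rightarrow> real) \<Rightarrow> 'a \<Rightarrow> 'a" where
  "pdp_step q P Vt bt x =
     (let dx = pdp_dx q P Vt bt x;
          \<omega> = - (first_deriv q x dx / hess q dx dx)
      in if dx = 0 then x else x + \<omega> *\<^sub>R dx)"

primrec pdp ::
    "('a::real_normed_vector \<Rightarrow> real) \<Rightarrow> ('a \<Rightarrow>\<^sub>L 'a) \<Rightarrow> 'a set \<Rightarrow> ('a \<Rightarrow> 'a \<Rightarrow> real) \<Rightarrow> 'a \<Rightarrow> nat \<Rightarrow> 'a" where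
  "pdp q P Vt bt x0 0 = x0"
| "pdp q P Vt bt x0 (Suc k) = pdp_step q P Vt bt (pdp q P Vt bt x0 k)"

section \<open>The quotient space\<close>

text \<open>The class of \<open>\<xi>\<close> modulo \<open>W\<close> is the coset \<open>\<xi> +o W\<close>, and the sum of two classes is their
  elementwise sum. The elementwise multiple of a class by \<open>0\<close> would be \<open>{0}\<close> instead of the
  zero class \<open>W\<close>, whence the extra summand \<open>W\<close> in \<open>class_scale\<close>.\<close>

definition quot_space :: "'a::real_vector set \<Rightarrow> 'a set set" where
  "quot_space W = range (\<lambda>\<xi>. \<xi> +o W)"

definition class_scale :: "'a::real_vector set \<Rightarrow> real \<Rightarrow> 'a set \<Rightarrow> 'a set" where
  "class_scale W t C = (\<lambda>x. t *\<^sub>R x) ` C + W"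

lemma class_add:
  fixes W :: "'a::real_vector set"
  assumes "subspace W"
  shows "(x +o W) + (y +o W) = (x + y) +o W"
proof -
  have "W + W = W"
    using assms by (force simp: set_plus_def subspace_add subspace_0)
  then show ?thesis by (simp add: set_plus_rearrange)
qed

lemma class_scale:
  fixes W :: "'a::real_vector set"
  assumes "subspace W"
  shows "class_scale W t (x +o W) = (t *\<^sub>R x) +o W"
proof (intro subset_antisym subsetI)
  fix y assume "y \<in> class_scale W t (x +o W)"
  then obtain w w' where w: "w \<in> W" "w' \<in> W" "y = t *\<^sub>R (x + w) + w'"
    by (auto simp: class_scale_def elt_set_plus_def set_plus_def)
  then have "y = t *\<^sub>R x + (t *\<^sub>R w + w')" by (simp add: scaleR_add_right)
  moreover have "t *\<^sub>R w + w' \<in> W"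
    using assms w by (simp add: subspace_add subspace_scale)
  ultimately show "y \<in> (t *\<^sub>R x) +o W" by (auto simp: elt_set_plus_def)
next
  fix y assume "y \<in> (t *\<^sub>R x) +o W"
  then obtain w where w: "w \<in> W" "y = t *\<^sub>R x + w" by (auto simp: elt_set_plus_def)
  have "x \<in> x +o W" using subspace_0[OF assms] by (force simp: elt_set_plus_def)
  then show "y \<in> class_scale W t (x +o W)"
    unfolding class_scale_def set_plus_def using w by blast
qed

section \<open>Steepest descent in the quotient space\<close>

text \<open>The function \<open>\<xi> \<mapsto> q (P \<xi>)\<close> is constant on each class modulo \<open>ker P\<close>.\<close>

definition quot_fun ::
    "('a::real_normed_vector \<Rightarrow> real) \<Rightarrow> ('a \<Rightarrow>\<^sub>L 'a) \<Rightarrow> 'a set \<Rightarrow> real" where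
  "quot_fun q P C = the_elem ((\<lambda>\<xi>. q (P \<xi>)) ` C)"

text \<open>Derivatives of \<open>f = quot_fun q P\<close> on the quotient space, evaluated as directional derivatives.
  The usual expressions in terms of representatives are \<open>quot_deriv_eq\<close> and
  \<open>quot_deriv2_eq\<close> below.\<close>

definition quot_deriv ::
    "('a::real_normed_vector \<Rightarrow> real) \<Rightarrow> ('a \<Rightarrow>\<^sub>L 'a) \<Rightarrow> 'a set \<Rightarrow> 'a set \<Rightarrow> real" where
  "quot_deriv q P C D = deriv (\<lambda>t. quot_fun q P (C + class_scale (ker P) t D)) 0"

definition quot_deriv2 ::
    "('a::real_normed_vector \<Rightarrow> real) \<Rightarrow> ('a \<Rightarrow>\<^sub>L 'a) \<Rightarrow> 'a set \<Rightarrow> 'a set \<Rightarrow> 'a set \<Rightarrow> real" where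
  "quot_deriv2 q P C D E = deriv (\<lambda>t. quot_deriv q P (C + class_scale (ker P) t D) E) 0"

text \<open>As an infimum of reals this is meaningful only if \<open>C\<close> meets \<open>Vt\<close>; every class does when
  \<open>range P \<subseteq> ker P + Vt\<close>.\<close>

definition quot_sqnorm :: "'a set \<Rightarrow> ('a \<Rightarrow> 'a \<Rightarrow> real) \<Rightarrow> 'a set \<Rightarrow> real" where
  "quot_sqnorm Vt bt C = (INF \<nu>\<in>C \<inter> Vt. bt \<nu> \<nu>)"

definition sd_direction ::
    "('a::real_normed_vector \<Rightarrow> real) \<Rightarrow> ('a \<Rightarrow>\<^sub>L 'a) \<Rightarrow> 'a set \<Rightarrow> ('a \<Rightarrow> 'a \<Rightarrow> real) \<Rightarrow> 'a set \<Rightarrow> 'a set" where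
  "sd_direction q P Vt bt C =
     arg_min (\<lambda>D. 1 / 2 * quot_sqnorm Vt bt D + quot_deriv q P C D)
       (\<lambda>D. D \<in> quot_space (ker P))"

definition sd_step ::
    "('a::real_normed_vector \<Rightarrow> real) \<Rightarrow> ('a \<Rightarrow>\<^sub>L 'a) \<Rightarrow> 'a set \<Rightarrow> ('a \<Rightarrow> 'a \<Rightarrow> real) \<Rightarrow> 'a set \<Rightarrow> 'a set" where
  "sd_step q P Vt bt C =
     (let D = sd_direction q P Vt bt C;
          \<omega> = - (quot_deriv q P C D / quot_deriv2 q P C D D)
      in if D = 0 +o ker P then C else C + class_scale (ker P) \<omega> D)"

primrec steepest_descent ::
    "('a::real_normed_vector \<Rightarrow> real) \<Rightarrow> ('a \<Rightarrow>\<^sub>L 'a) \<Rightarrow> 'a set \<Rightarrow> ('a \<Rightarrow> 'a \<Rightarrow> real) \<Rightarrow>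
      'a set \<Rightarrow> nat \<Rightarrow> 'a set" where
  "steepest_descent q P Vt bt C0 0 = C0"
| "steepest_descent q P Vt bt C0 (Suc k) =
     sd_step q P Vt bt (steepest_descent q P Vt bt C0 k)"

section \<open>Basic properties of the derivatives\<close>

lemma second_order_expansion:
  fixes q :: "'a::real_normed_vector \<Rightarrow> real"
  assumes "quadratic_function q" and "continuous_on UNIV q"
  shows has_derivative_first_deriv: "(q has_derivative first_deriv q x) (at x)"
    and second_deriv_const: "second_deriv q x = hess q"
    and bounded_bilinear_hess: "bounded_bilinear (hess q)"
    and hess_commute: "hess q u v = hess q v u"
    and quadratic_expansion: "q (x + h) = q x + first_deriv q x h + 1 / 2 * hess q h h"
    and first_deriv_add: "first_deriv q (x + h) v = first_deriv q x v + hess q h v"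
proof -
  obtain c l B where l: "linear l" and B: "bilinear B" and sym: "\<And>u v. B u v = B v u"
    and q: "\<And>x. q x = c + l x + 1 / 2 * B x x"
    using assms(1) unfolding quadratic_function_def by blast
  have lB: "linear (B u)" "linear (\<lambda>u. B u v)" for u v
    using B by (auto simp: bilinear_def)
  note Bs = bilinear_ladd[OF B] bilinear_radd[OF B] bilinear_lmul[OF B] bilinear_rmul[OF B]
    bilinear_lneg[OF B] bilinear_rneg[OF B]
  have cq: "isCont q x" for x
    using assms(2) by (simp add: continuous_on_eq_continuous_at)
  have q0: "q 0 = c"
    using q[of 0] linear_0[OF l] bilinear_lzero[OF B] by simp
  have "isCont q 0" by (rule cq)
  then obtain d where d: "d > 0" "\<And>x. norm x < d \<Longrightarrow> \<bar>q x - c\<bar> < 1"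
    unfolding continuous_at_eps_delta using q0
    by (metis dist_norm diff_zero real_norm_def zero_less_one)
  define e where "e = d / 4"
  have e: "e > 0" using d by (simp add: e_def)
  have lb: "\<bar>l x\<bar> \<le> 1" if "norm x \<le> e" for x
  proof -
    have "2 * l x = (q x - c) - (q (- x) - c)"
      by (simp add: q linear_neg[OF l] Bs)
    moreover have "\<bar>q x - c\<bar> < 1" "\<bar>q (- x) - c\<bar> < 1"
      using that d by (auto simp: e_def)
    ultimately show ?thesis by linarith
  qed
  have Bb: "\<bar>B x y\<bar> \<le> 3" if "norm x \<le> e" "norm y \<le> e" for x y
  proof -
    have "B x y = (q (x + y) - c) - (q x - c) - (q y - c)"
      using sym[of x y] by (simp add: q linear_add[OF l] Bs algebra_simps)
    moreover have "norm (x + y) < d"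
      using norm_triangle_ineq[of x y] that d e_def by linarith
    then have "\<bar>q (x + y) - c\<bar> < 1" using d by blast
    moreover have "\<bar>q x - c\<bar> < 1" "\<bar>q y - c\<bar> < 1"
      using that d by (auto simp: e_def)
    ultimately show ?thesis by linarith
  qed
  have nrm: "norm ((e / norm x) *\<^sub>R x) \<le> e" for x :: 'a
    using e by (cases "x = 0") auto
  have lbd: "\<bar>l x\<bar> \<le> norm x * (1 / e)" for x
  proof (cases "x = 0")
    case False
    have "\<bar>l ((e / norm x) *\<^sub>R x)\<bar> \<le> 1" using lb[OF nrm] .
    then show ?thesis
      using False e by (simp add: linear_scale[OF l] abs_mult field_simps)
  qed (simp add: linear_0[OF l])
  have Bbd: "\<bar>B x y\<bar> \<le> norm x * norm y * (3 / e\<^sup>2)" for x y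
  proof (cases "x = 0 \<or> y = 0")
    case True
    then show ?thesis using bilinear_lzero[OF B] bilinear_rzero[OF B] by auto
  next
    case False
    have "\<bar>B ((e / norm x) *\<^sub>R x) ((e / norm y) *\<^sub>R y)\<bar> \<le> 3"
      using Bb[OF nrm nrm] .
    then show ?thesis
      using False e by (simp add: Bs abs_mult field_simps power2_eq_square)
  qed
  have bl: "bounded_linear l"
    using l lbd by (intro bounded_linear_intro[where K = "1 / e"])
      (auto simp: linear_add linear_scale)
  have bB: "bounded_bilinear B"
    by (rule bounded_bilinear.intro)
      (use Bbd in \<open>auto simp: Bs intro!: exI[of _ "3 / e\<^sup>2"]\<close>)
  interpret bB: bounded_bilinear B by (rule bB)
  define D where "D = (\<lambda>x. Blinfun l + Blinfun (B x))"
  have D: "blinfun_apply (D x) h = l h + B x h" for x h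
    by (simp add: D_def plus_blinfun.rep_eq bounded_linear_Blinfun_apply bl
        bB.bounded_linear_right)
  have dq: "(q has_derivative D x) (at x)" for x
  proof -
    have "((\<lambda>x. c + l x + 1 / 2 * B x x) has_derivative (\<lambda>h. l h + B x h)) (at x)"
      by (rule has_derivative_eq_rhs,
          (rule derivative_intros bounded_linear.has_derivative[OF bl] bB.FDERIV)+)
        (use sym in auto)
    moreover have "q = (\<lambda>x. c + l x + 1 / 2 * B x x)" using q by (rule ext)
    moreover have "blinfun_apply (D x) = (\<lambda>h. l h + B x h)" using D by (rule ext)
    ultimately show ?thesis by (simp only:)
  qed
  have fd: "first_deriv q x = D x" for x
    using frechet_derivative_at[OF dq[of x]]
    by (metis blinfun_apply_inverse first_deriv_def)
  have blB: "bounded_linear (\<lambda>u. Blinfun (B u))"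
  proof (rule bounded_linear_intro[where K = "3 / e\<^sup>2"])
    have a: "blinfun_apply (Blinfun (B u)) v = B u v" for u v
      by (simp add: bounded_linear_Blinfun_apply bB.bounded_linear_right)
    show "Blinfun (B (x + y)) = Blinfun (B x) + Blinfun (B y)" for x y
      by (rule blinfun_eqI) (simp add: a plus_blinfun.rep_eq Bs)
    show "Blinfun (B (r *\<^sub>R x)) = r *\<^sub>R Blinfun (B x)" for r x
      by (rule blinfun_eqI) (simp add: a scaleR_blinfun.rep_eq Bs)
    show "norm (Blinfun (B x)) \<le> norm x * (3 / e\<^sup>2)" for x
      by (rule norm_blinfun_bound) (use e Bbd[of x] in \<open>auto simp: a mult_ac\<close>)
  qed
  have "(D has_derivative (\<lambda>u. Blinfun (B u))) (at x)" for x
    unfolding D_def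
    by (rule has_derivative_eq_rhs,
        (rule derivative_intros bounded_linear.has_derivative[OF blB])+) auto
  then have "frechet_derivative (first_deriv q) (at x) = (\<lambda>u. Blinfun (B u))" for x
    using frechet_derivative_at fd by (metis ext)
  then have sd: "second_deriv q x = B" for x
    by (intro ext)
      (simp add: second_deriv_def bounded_linear_Blinfun_apply bB.bounded_linear_right)
  then have h: "hess q = B" by (simp add: hess_def)
  show "(q has_derivative first_deriv q x) (at x)" by (simp add: fd dq)
  show "second_deriv q x = hess q" by (simp add: sd h)
  show "bounded_bilinear (hess q)" by (simp add: h bB)
  show "hess q u v = hess q v u" by (simp add: h sym)
  show "q (x + h) = q x + first_deriv q x h + 1 / 2 * hess q h h"
    using sym[of x h] by (simp add: fd D h q linear_add[OF l] Bs algebra_simps)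
  show "first_deriv q (x + h) v = first_deriv q x v + hess q h v"
    by (simp add: fd D h Bs)
qed

lemma subspace_ker: "subspace (ker P)"
  by (auto simp: ker_def subspace_def blinfun.bilinear_simps)

lemma quot_fun_eq: "quot_fun q P (\<xi> +o ker P) = q (P \<xi>)"
proof -
  have "(\<lambda>\<xi>. q (P \<xi>)) ` (\<xi> +o ker P) = {q (P \<xi>)}"
    using subspace_0[OF subspace_ker[of P]]
    by (auto simp: elt_set_plus_def ker_def blinfun.bilinear_simps image_iff)
  then show ?thesis by (simp add: quot_fun_def)
qed

lemma quot_deriv_eq:
  fixes q :: "'a::real_normed_vector \<Rightarrow> real"
  assumes "quadratic_function q" and "continuous_on UNIV q"
  shows "quot_deriv q P (\<xi> +o ker P) (v +o ker P) = first_deriv q (P \<xi>) (P v)"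
proof -
  interpret bounded_bilinear "hess q" by (rule bounded_bilinear_hess[OF assms])
  have "quot_fun q P ((\<xi> +o ker P) + class_scale (ker P) t (v +o ker P)) =
      q (P \<xi>) + t * first_deriv q (P \<xi>) (P v) + t\<^sup>2 * (1 / 2 * hess q (P v) (P v))" for t
    using quadratic_expansion[OF assms, of "P \<xi>" "t *\<^sub>R P v"]
    by (simp add: class_scale class_add subspace_ker quot_fun_eq blinfun.bilinear_simps
        scaleR_left scaleR_right power2_eq_square)
  moreover have "((\<lambda>t. q (P \<xi>) + t * first_deriv q (P \<xi>) (P v) +
      t\<^sup>2 * (1 / 2 * hess q (P v) (P v))) has_field_derivative
      first_deriv q (P \<xi>) (P v)) (at 0)"
    by (auto intro!: derivative_eq_intros)
  ultimately show ?thesis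
    unfolding quot_deriv_def by (simp add: DERIV_imp_deriv)
qed

lemma quot_deriv2_eq:
  fixes q :: "'a::real_normed_vector \<Rightarrow> real"
  assumes "quadratic_function q" and "continuous_on UNIV q"
  shows "quot_deriv2 q P (\<xi> +o ker P) (u +o ker P) (v +o ker P) = hess q (P u) (P v)"
proof -
  interpret bounded_bilinear "hess q" by (rule bounded_bilinear_hess[OF assms])
  have "quot_deriv q P ((\<xi> +o ker P) + class_scale (ker P) t (u +o ker P)) (v +o ker P) =
      first_deriv q (P \<xi>) (P v) + t * hess q (P u) (P v)" for t
    by (simp add: class_scale class_add subspace_ker quot_deriv_eq[OF assms]
        blinfun.add_right blinfun.scaleR_right first_deriv_add[OF assms] scaleR_left)
  moreover have "((\<lambda>t. first_deriv q (P \<xi>) (P v) + t * hess q (P u) (P v))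
      has_field_derivative hess q (P u) (P v)) (at 0)"
    by (auto intro!: derivative_eq_intros)
  ultimately show ?thesis
    unfolding quot_deriv2_def by (simp add: DERIV_imp_deriv)
qed

end

theory Submission
  imports Defs
begin

text \<open>Both algorithms minimize the same energy. Write \<open>l = q'(x)\<close> with \<open>x \<in> V\<close>. By the choice of the
  multiplier, \<open>l + \<lambda> = l \<circ> P\<close>, so the primal dual direction minimizes
  \<open>J v = l (P v) + 1/2 * bt v v\<close> over \<open>Vt\<close>. The linear part of \<open>J\<close> is constant on classes modulo
  \<open>W\<close>. The objective of steepest descent at a class \<open>D\<close> is therefore the infimum of \<open>J\<close> over
  \<open>D \<inter> Vt\<close>, and minimizing over \<open>D\<close> afterwards is minimization of \<open>J\<close> in two stages: \<open>Vt\<close> is the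
  union of its intersections with the classes, and none of these is empty because
  \<open>V \<subseteq> W + Vt\<close> (\<open>coset_ker_meets\<close>).

  Hence the class of the minimizer \<open>y\<close> of \<open>J\<close> is a minimizer in the quotient. For the iterates to
  agree it has to be the only one, and here strict inequality of \<open>J\<close> off \<open>y\<close> would be lost in the
  infimum over a class. This is why \<open>elliptic_energy_minimizer\<close> gives quadratic growth of \<open>J\<close>
  around \<open>y\<close>: all points of a class other than \<open>y + W\<close> stay at a positive distance from \<open>y\<close>, because \<open>P\<close> is
  bounded, so that the infimum of \<open>J\<close> over such a class exceeds \<open>J y\<close> strictly
  (\<open>quot_energy_growth\<close>).

  With \<open>[y]\<close> and \<open>P y\<close> as the two directions, the step lengths agree since both are computed from
  the derivatives of \<open>q\<close> at \<open>x\<close> along \<open>P y\<close>. The induction carries the stronger invariant that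
  \<open>x\<^sub>k \<in> V\<close> and that the \<open>k\<close>-th class equals \<open>x\<^sub>k + W\<close>.\<close>

section \<open>Minimization of elliptic quadratic energies\<close>

definition energy :: "('a \<Rightarrow> real) \<Rightarrow> ('a \<Rightarrow> 'a \<Rightarrow> real) \<Rightarrow> 'a \<Rightarrow> real" where
  "energy \<phi> B v = \<phi> v + 1 / 2 * B v v"

lemma energy_midpoint:
  fixes \<phi> :: "'a::real_normed_vector \<Rightarrow> real"
  assumes "bounded_linear \<phi>" and "bounded_bilinear B"
  shows "energy \<phi> B u + energy \<phi> B v - 2 * energy \<phi> B ((1 / 2) *\<^sub>R (u + v)) =
    1 / 4 * B (u - v) (u - v)"
proof -
  interpret \<phi>: bounded_linear \<phi> by fact
  interpret B: bounded_bilinear B by fact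
  show ?thesis
    by (simp add: energy_def \<phi>.add \<phi>.scaleR B.add_left B.add_right B.diff_left B.diff_right
        B.scaleR_left B.scaleR_right algebra_simps)
qed

text \<open>Completing the square: \<open>K r \<le> K\<^sup>2 / (2 \<alpha>) + \<alpha> r\<^sup>2 / 2\<close> absorbs the linear part.\<close>

lemma elliptic_energy_bdd_below:
  fixes \<phi> :: "'a::real_normed_vector \<Rightarrow> real"
  assumes \<phi>: "bounded_linear \<phi>" and ell: "elliptic_on S B"
  shows "bdd_below (energy \<phi> B ` S)"
proof -
  obtain \<alpha> where \<alpha>: "\<alpha> > 0" "\<And>v. v \<in> S \<Longrightarrow> B v v \<ge> \<alpha> * (norm v)\<^sup>2"
    using ell unfolding elliptic_on_def by blast
  obtain K where K: "\<And>v. \<bar>\<phi> v\<bar> \<le> norm v * K"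
    using bounded_linear.bounded[OF \<phi>] by auto
  have "- (K\<^sup>2 / (2 * \<alpha>)) \<le> energy \<phi> B v" if "v \<in> S" for v
  proof -
    have "0 \<le> (\<alpha> * norm v - K)\<^sup>2 / (2 * \<alpha>)" using \<alpha> by simp
    also have "\<dots> = 1 / 2 * (\<alpha> * (norm v)\<^sup>2) - norm v * K + K\<^sup>2 / (2 * \<alpha>)"
      using \<alpha>(1) by (simp add: field_simps power2_eq_square)
    finally show ?thesis
      using \<alpha>(2)[OF that] K[of v] unfolding energy_def by linarith
  qed
  then show ?thesis by (intro bdd_belowI2)
qed

text \<open>The direct method. The midpoint identity bounds the distance of two points of \<open>S\<close> by the
  excess of their energies over the infimum. It thus makes minimizing sequences Cauchy and, applied
  to a point and the minimizer, gives the quadratic growth.\<close>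

lemma elliptic_energy_minimizer:
  fixes \<phi> :: "'a::{real_normed_vector, complete_space} \<Rightarrow> real"
  assumes \<phi>: "bounded_linear \<phi>" and B: "bounded_bilinear B"
    and S: "subspace S" "closed S" and ell: "elliptic_on S B"
  obtains y c where "y \<in> S" "c > 0"
    "\<And>v. v \<in> S \<Longrightarrow> energy \<phi> B y + c * (norm (v - y))\<^sup>2 \<le> energy \<phi> B v"
proof -
  interpret \<phi>: bounded_linear \<phi> by fact
  interpret B: bounded_bilinear B by fact
  let ?J = "energy \<phi> B"
  obtain \<alpha> where \<alpha>: "\<alpha> > 0" "\<And>v. v \<in> S \<Longrightarrow> B v v \<ge> \<alpha> * (norm v)\<^sup>2"
    using ell unfolding elliptic_on_def by blast
  define m where "m = (INF v\<in>S. ?J v)"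
  have bdd: "bdd_below (?J ` S)" by (rule elliptic_energy_bdd_below[OF \<phi> ell])
  have ne: "S \<noteq> {}" using subspace_0[OF S(1)] by blast
  have m_le: "m \<le> ?J v" if "v \<in> S" for v
    unfolding m_def by (rule cINF_lower[OF bdd that])
  have dist_le: "\<alpha> / 4 * (norm (u - v))\<^sup>2 \<le> (?J u - m) + (?J v - m)"
    if "u \<in> S" "v \<in> S" for u v
  proof -
    have "m \<le> ?J ((1 / 2) *\<^sub>R (u + v))"
      using that by (intro m_le subspace_scale subspace_add S)
    moreover have "\<alpha> * (norm (u - v))\<^sup>2 \<le> B (u - v) (u - v)"
      using that by (intro \<alpha> subspace_diff S)
    ultimately show ?thesis using energy_midpoint[OF \<phi> B, of u v] by simp
  qed
  have "\<exists>v\<in>S. ?J v < m + 1 / real (Suc n)" for n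
  proof -
    have "m < m + 1 / real (Suc n)" by simp
    then show ?thesis unfolding m_def using cINF_less_iff[OF ne bdd] by blast
  qed
  then obtain s where s: "\<And>n. s n \<in> S" "\<And>n. ?J (s n) < m + 1 / real (Suc n)" by metis
  have "Cauchy s"
  proof (rule metric_CauchyI)
    fix e :: real assume e: "e > 0"
    then have "\<alpha> / 8 * e\<^sup>2 > 0" using \<alpha> by simp
    then obtain M where M: "1 / real (Suc M) < \<alpha> / 8 * e\<^sup>2" using nat_approx_posE by blast
    have excess: "?J (s n) - m < \<alpha> / 8 * e\<^sup>2" if "n \<ge> M" for n
    proof -
      have "1 / real (Suc n) \<le> 1 / real (Suc M)" using that by (simp add: frac_le)
      then show ?thesis using s(2)[of n] M by linarith
    qed
    have "dist (s i) (s j) < e" if "i \<ge> M" "j \<ge> M" for i j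
    proof -
      have "\<alpha> / 4 * (norm (s i - s j))\<^sup>2 < \<alpha> / 4 * e\<^sup>2"
        using dist_le[OF s(1) s(1), of i j] excess[OF that(1)] excess[OF that(2)] by argo
      then have "(norm (s i - s j))\<^sup>2 < e\<^sup>2" using \<alpha>(1) by simp
      then show ?thesis using e by (simp add: dist_norm power_less_imp_less_base)
    qed
    then show "\<exists>M. \<forall>i\<ge>M. \<forall>j\<ge>M. dist (s i) (s j) < e" by blast
  qed
  then obtain y where y: "s \<longlonglongrightarrow> y" by (auto simp: Cauchy_convergent_iff convergent_def)
  have yS: "y \<in> S" using closed_sequentially[OF S(2)] s(1) y by blast
  have "(\<lambda>n. ?J (s n)) \<longlonglongrightarrow> ?J y"
    unfolding energy_def by (intro tendsto_intros \<phi>.tendsto B.tendsto y)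
  moreover have "(\<lambda>n. m + 1 / real (Suc n)) \<longlonglongrightarrow> m"
    using tendsto_add[OF tendsto_const LIMSEQ_inverse_real_of_nat, of m]
    by (simp add: inverse_eq_divide)
  ultimately have "?J y \<le> m" using s(2) by (intro LIMSEQ_le) (auto intro: less_imp_le)
  then have "?J y = m" using m_le[OF yS] by simp
  then have "?J y + \<alpha> / 4 * (norm (v - y))\<^sup>2 \<le> ?J v" if "v \<in> S" for v
    using dist_le[OF that yS] by simp
  then show thesis using that[of y "\<alpha> / 4"] yS \<alpha> by simp
qed

lemma arg_min_eqI:
  fixes f :: "'a \<Rightarrow> 'b::linorder"
  assumes "Q y" and "\<And>v. Q v \<Longrightarrow> v \<noteq> y \<Longrightarrow> f y < f v"
  shows "arg_min f Q = y"
  unfolding arg_min_def is_arg_min_def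
proof (rule some_equality)
  show "Q y \<and> \<not> (\<exists>v. Q v \<and> f v < f y)"
    using assms by (metis order_less_asym)
qed (use assms in blast)

section \<open>Classes modulo the kernel\<close>

lemma mem_coset_ker_iff: "\<eta> \<in> \<xi> +o ker P \<longleftrightarrow> P \<eta> = P \<xi>"
proof
  assume "P \<eta> = P \<xi>"
  then have "\<eta> - \<xi> \<in> ker P" by (simp add: ker_def blinfun.diff_right)
  then show "\<eta> \<in> \<xi> +o ker P" by (force simp: elt_set_plus_def)
qed (auto simp: elt_set_plus_def ker_def blinfun.add_right)

lemma coset_ker_eq_iff: "\<eta> +o ker P = \<xi> +o ker P \<longleftrightarrow> P \<eta> = P \<xi>"
proof
  assume "\<eta> +o ker P = \<xi> +o ker P"
  then show "P \<eta> = P \<xi>" using mem_coset_ker_iff[of \<eta>] by auto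
qed (simp add: set_eq_iff mem_coset_ker_iff)

text \<open>Since \<open>\<xi> - P \<xi> \<in> ker P\<close>, the inclusion for the range of \<open>P\<close> extends to all of the space.\<close>

lemma coset_ker_meets:
  assumes "P o\<^sub>L P = P" and "range (blinfun_apply P) \<subseteq> ker P + S"
  shows "(\<xi> +o ker P) \<inter> S \<noteq> {}"
proof -
  have idem: "P (P \<xi>) = P \<xi>" using assms(1) by (metis blinfun_apply_blinfun_compose)
  obtain w v where "w \<in> ker P" "v \<in> S" "P \<xi> = w + v"
    using assms(2) by (fastforce simp: set_plus_def)
  moreover from this have "P v = P \<xi>"
    using idem by (simp add: ker_def blinfun.add_right)
  ultimately show ?thesis by (auto simp: mem_coset_ker_iff)
qed

section \<open>The two search directions\<close>

lemma quot_sqnorm_le: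
  assumes "elliptic_on Vt bt" and "y \<in> C" "y \<in> Vt"
  shows "quot_sqnorm Vt bt C \<le> bt y y"
proof -
  obtain \<alpha> where \<alpha>: "\<alpha> > 0" "\<And>v. v \<in> Vt \<Longrightarrow> bt v v \<ge> \<alpha> * (norm v)\<^sup>2"
    using assms(1) unfolding elliptic_on_def by blast
  have "0 \<le> bt v v" if "v \<in> Vt" for v
    using \<alpha>(2)[OF that] \<alpha>(1) by (smt (verit) mult_nonneg_nonneg zero_le_power2)
  then have "bdd_below ((\<lambda>\<nu>. bt \<nu> \<nu>) ` (C \<inter> Vt))" by (intro bdd_belowI2) auto
  then show ?thesis unfolding quot_sqnorm_def using assms(2,3) by (intro cINF_lower) auto
qed

text \<open>Quadratic growth descends to the quotient. All representatives \<open>\<nu>\<close> of \<open>[\<xi>]\<close> satisfy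
  \<open>norm (P \<xi> - P y) \<le> norm P * norm (\<nu> - y)\<close>, so the growth term has a lower bound that depends on
  the class only and survives the infimum.\<close>

lemma quot_energy_growth:
  fixes P :: "'a::real_normed_vector \<Rightarrow>\<^sub>L 'a" and l :: "'a \<Rightarrow> real"
  assumes "c > 0"
    and growth: "\<And>v. v \<in> Vt \<Longrightarrow>
      energy (\<lambda>v. l (P v)) bt y + c * (norm (v - y))\<^sup>2 \<le> energy (\<lambda>v. l (P v)) bt v"
    and meets: "(\<xi> +o ker P) \<inter> Vt \<noteq> {}"
    and ne: "P \<xi> \<noteq> P y"
  shows "energy (\<lambda>v. l (P v)) bt y < 1 / 2 * quot_sqnorm Vt bt (\<xi> +o ker P) + l (P \<xi>)"
proof -
  let ?J = "energy (\<lambda>v. l (P v)) bt"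
  let ?gap = "c * (norm (P \<xi> - P y) / norm P)\<^sup>2"
  have P: "norm P > 0" using ne by auto
  have "2 * (?J y + ?gap - l (P \<xi>)) \<le> bt \<nu> \<nu>" if "\<nu> \<in> (\<xi> +o ker P) \<inter> Vt" for \<nu>
  proof -
    have \<nu>: "P \<nu> = P \<xi>" "\<nu> \<in> Vt" using that by (auto simp: mem_coset_ker_iff)
    have "norm (P \<xi> - P y) \<le> norm P * norm (\<nu> - y)"
      using norm_blinfun[of P "\<nu> - y"] \<nu>(1) by (simp add: blinfun.diff_right)
    then have "norm (P \<xi> - P y) / norm P \<le> norm (\<nu> - y)"
      using P by (simp add: divide_le_eq mult.commute)
    then have "?gap \<le> c * (norm (\<nu> - y))\<^sup>2"
      using \<open>c > 0\<close> by (intro mult_left_mono power_mono) auto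
    then show ?thesis using growth[OF \<nu>(2)] \<nu>(1) by (simp add: energy_def)
  qed
  then have "2 * (?J y + ?gap - l (P \<xi>)) \<le> quot_sqnorm Vt bt (\<xi> +o ker P)"
    unfolding quot_sqnorm_def by (intro cINF_greatest meets)
  moreover have "?gap > 0" using \<open>c > 0\<close> P ne by simp
  ultimately show ?thesis by argo
qed

text \<open>Passing to the class \<open>y + W\<close> does not raise the objective above \<open>J y\<close>, since \<open>y\<close> is itself a
  representative in \<open>Vt\<close>, whereas in every other class the objective lies above \<open>J y\<close>. The
  multiplier is what removes the component of \<open>q'(x)\<close> that would see \<open>W\<close>.\<close>

lemma sd_direction_eq_coset_pdp_dy:
  fixes q :: "'a::{real_normed_vector, complete_space} \<Rightarrow> real"
  assumes projection: "P o\<^sub>L P = P"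
    and q: "quadratic_function q" "continuous_on UNIV q"
    and Vt: "subspace Vt" "closed Vt"
    and bt: "bounded_bilinear bt" "elliptic_on Vt bt"
    and range: "range (blinfun_apply P) \<subseteq> ker P + Vt"
    and x: "P x = x"
  shows "sd_direction q P Vt bt (x +o ker P) = pdp_dy q P Vt bt x +o ker P"
proof -
  define l where "l = blinfun_apply (first_deriv q x)"
  let ?J = "energy (\<lambda>v. l (P v)) bt"
  have "bounded_linear (\<lambda>v. l (P v))"
    unfolding l_def by (intro bounded_linear_intros)
  from elliptic_energy_minimizer[OF this bt(1) Vt bt(2)]
  obtain y c where y: "y \<in> Vt" "c > 0"
    and growth: "\<And>v. v \<in> Vt \<Longrightarrow> ?J y + c * (norm (v - y))\<^sup>2 \<le> ?J v"
    by blast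
  \<comment> \<open>\<open>pdp_lambda\<close> replaces \<open>l v\<close> by \<open>l (P v)\<close>.\<close>
  have objective: "(\<lambda>v. first_deriv q x v + 1 / 2 * bt v v + pdp_lambda q P x v) = ?J"
    by (auto simp: energy_def l_def pdp_lambda_def dual_adjoint_def blinfun.diff_left)
  have dy: "pdp_dy q P Vt bt x = y"
    unfolding pdp_dy_def objective
  proof (rule arg_min_eqI)
    show "?J y < ?J v" if "v \<in> Vt" "v \<noteq> y" for v
    proof -
      have "c * (norm (v - y))\<^sup>2 > 0" using that y(2) by simp
      then show ?thesis using growth[OF that(1)] by linarith
    qed
  qed (rule y)
  have l_eq: "quot_deriv q P (x +o ker P) (\<xi> +o ker P) = l (P \<xi>)" for \<xi>
    by (simp add: quot_deriv_eq[OF q] x l_def)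
  have "sd_direction q P Vt bt (x +o ker P) = y +o ker P"
    unfolding sd_direction_def
  proof (rule arg_min_eqI)
    fix D assume "D \<in> quot_space (ker P)" and ne: "D \<noteq> y +o ker P"
    then obtain \<xi> where \<xi>: "D = \<xi> +o ker P" by (auto simp: quot_space_def)
    have "1 / 2 * quot_sqnorm Vt bt (y +o ker P) + l (P y) \<le> ?J y"
      using quot_sqnorm_le[OF bt(2) _ y(1), of "y +o ker P"]
      by (simp add: mem_coset_ker_iff energy_def)
    also have "?J y < 1 / 2 * quot_sqnorm Vt bt D + l (P \<xi>)"
      unfolding \<xi>
      by (rule quot_energy_growth[OF y(2) growth coset_ker_meets[OF projection range]])
        (use ne \<xi> coset_ker_eq_iff in auto)
    finally show "1 / 2 * quot_sqnorm Vt bt (y +o ker P) +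
        quot_deriv q P (x +o ker P) (y +o ker P) <
        1 / 2 * quot_sqnorm Vt bt D + quot_deriv q P (x +o ker P) D"
      by (simp add: \<xi> l_eq)
  qed (simp add: quot_space_def)
  then show ?thesis by (simp add: dy)
qed

section \<open>The iterates\<close>

lemma sd_step_eq_coset_pdp_step:
  fixes q :: "'a::{real_normed_vector, complete_space} \<Rightarrow> real"
  assumes projection: "P o\<^sub>L P = P"
    and q: "quadratic_function q" "continuous_on UNIV q"
    and Vt: "subspace Vt" "closed Vt"
    and bt: "bounded_bilinear bt" "elliptic_on Vt bt"
    and range: "range (blinfun_apply P) \<subseteq> ker P + Vt"
    and x: "P x = x"
  shows "sd_step q P Vt bt (x +o ker P) = pdp_step q P Vt bt x +o ker P"
    and "P (pdp_step q P Vt bt x) = pdp_step q P Vt bt x"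
proof -
  have idem: "P (P v) = P v" for v
    using projection by (metis blinfun_apply_blinfun_compose)
  define y where "y = pdp_dy q P Vt bt x"
  have D: "sd_direction q P Vt bt (x +o ker P) = y +o ker P"
    unfolding y_def by (rule sd_direction_eq_coset_pdp_dy[OF assms])
  have zero: "y +o ker P = 0 +o ker P \<longleftrightarrow> P y = 0"
    unfolding coset_ker_eq_iff by simp
  show "sd_step q P Vt bt (x +o ker P) = pdp_step q P Vt bt x +o ker P"
    unfolding sd_step_def pdp_step_def pdp_dx_def Let_def D y_def[symmetric] zero
      quot_deriv_eq[OF q] quot_deriv2_eq[OF q] class_scale[OF subspace_ker]
      class_add[OF subspace_ker] x
    by (auto simp: coset_ker_eq_iff blinfun.bilinear_simps idem)
  show "P (pdp_step q P Vt bt x) = pdp_step q P Vt bt x"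
    unfolding pdp_step_def pdp_dx_def Let_def by (simp add: blinfun.bilinear_simps idem x)
qed

theorem proposition4p2:
  fixes q :: "'a::{real_inner, complete_space} \<Rightarrow> real"
    and P :: "'a \<Rightarrow>\<^sub>L 'a"
    and V W Vt :: "'a set"
    and bt :: "'a \<Rightarrow> 'a \<Rightarrow> real"
    and x0 \<xi>0 :: 'a
  assumes projection: "P o\<^sub>L P = P"
    and V: "V = range (blinfun_apply P)"
    and W: "W = ker P"
    and q: "quadratic_function q" "continuous_on UNIV q"
    and pos_def: "\<forall>v\<in>V. v \<noteq> 0 \<longrightarrow> hess q v v > 0"
    and Vt: "subspace Vt" "closed Vt"
    and bt: "bounded_bilinear bt" "\<forall>u v. bt u v = bt v u" "elliptic_on Vt bt"
    and V_subset: "V \<subseteq> W + Vt"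
    and init: "x0 \<in> V" "x0 \<in> \<xi>0 +o W"
  shows "\<forall>k. pdp q P Vt bt x0 k \<in> steepest_descent q P Vt bt (\<xi>0 +o W) k"
proof -
  have idem: "P (P v) = P v" for v
    using projection by (metis blinfun_apply_blinfun_compose)
  note step = sd_step_eq_coset_pdp_step[OF projection q Vt bt(1,3) V_subset[unfolded V W]]
  have x0: "P x0 = x0" using init(1) V idem by auto
  have "\<xi>0 +o W = x0 +o W"
    using init(2) unfolding W mem_coset_ker_iff coset_ker_eq_iff by simp
  then have "P (pdp q P Vt bt x0 k) = pdp q P Vt bt x0 k \<and>
      steepest_descent q P Vt bt (\<xi>0 +o W) k = pdp q P Vt bt x0 k +o W" for k
    by (induction k) (auto simp: x0 W step)
  then show ?thesis by (simp add: W mem_coset_ker_iff)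
qed

end
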